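(* Let $d\ge 1$ and let $p\in \mathbb{R}[x_1,\ldots,x_d]$. If $\overline{p}$ is nonnegative on $[0,\infty)^d$, then $T_p$ has the Stieltjes moment property.
   Context: $\mathbb{N}_0$ denotes the set of nonnegative integers, $\mathcal{A}$ the set of all real sequences $\alpha=(\alpha_n)_{n\in\mathbb{N}_0}$, and $\mathcal{S}$ the set of all permutations of $\{1,\ldots,d\}$. A sequence $\alpha\in\mathcal{A}$ is a Stieltjes moment sequence if there is a nonnegative Borel measure $\mu$ on $\mathbb{R}$ with $\operatorname{supp}(\mu)\subset[0,\infty)$ such that $\alpha_n=\int_{[0,\infty)} x^n\,d\mu$ for all $n\in\mathbb{N}_0$ (all these integrals existing). For a polynomial $p=\sum_{\boldsymbol{i}\in\mathbb{N}_0^d} p_{\boldsymbol{i}}\,x_1^{i_1}\cdots x_d^{i_d}\in\mathbb{R}[x_1,\ldots,x_d]$ (where $\boldsymbol{i}=(i_1,\ldots,i_d)$), the map $T_p:\mathcal{A}\to\mathcal{A}$ is defined by $T_p(\alpha)=(\tilde\alpha_n)_{n\in\mathbb{N}_0}$ with $\tilde\alpha_n=\sum_{\boldsymbol{i}} p_{\boldsymbol{i}}\,\alpha_{n+i_1}\alpha_{n+i_2}\cdots\alpha_{n+i_d}$. $T_p$ has the Stieltjes moment property if, for every Stieltjes moment sequence $\alpha$, the sequence $T_p(\alpha)$ is a Stieltjes moment sequence. For $p\in\mathbb{R}[x_1,\ldots,x_d]$, the polynomial $\overline{p}\in\mathbb{R}[x_1,\ldots,x_d]$ is defined by $$\overline{p}(x_1,\ldots,x_d)=\frac{1}{d!}\sum_{\pi\in\mathcal{S}}p(x_{\pi(1)},\ldots,x_{\pi(d)}).$$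 *)

theory Defs
  imports
    "HOL-Analysis.Analysis"
    "HOL-Combinatorics.Permutations"
    "HOL-Library.Poly_Mapping"
begin

section \<open>Real polynomials in \<open>d\<close> variables\<close>

text \<open>
  A polynomial is the finitely supported family of its coefficients \<open>p\<^sub>i\<close>; an exponent vector
  \<open>i\<close> is a finitely supported function from variable indices to exponents. The variables
  \<open>x\<^sub>1, \<dots>, x\<^sub>d\<close> have the indices \<open>1, \<dots>, d\<close>.
\<close>

type_synonym real_mpoly = "(nat \<Rightarrow>\<^sub>0 nat) \<Rightarrow>\<^sub>0 real"

definition polynomials_in :: "nat \<Rightarrow> real_mpoly set" where
  "polynomials_in d = {p. \<forall>i \<in> Poly_Mapping.keys p. Poly_Mapping.keys i \<subseteq> {1..d}}"

definition poly_const :: "real \<Rightarrow> real_mpoly" where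
  "poly_const c = Poly_Mapping.single 0 c"

definition poly_var :: "nat \<Rightarrow> real_mpoly" where
  "poly_var k = Poly_Mapping.single (Poly_Mapping.single k 1) 1"

definition poly_eval :: "real_mpoly \<Rightarrow> (nat \<Rightarrow> real) \<Rightarrow> real" where
  "poly_eval p x =
     (\<Sum>i \<in> Poly_Mapping.keys p. Poly_Mapping.lookup p i *
        (\<Prod>k \<in> Poly_Mapping.keys i. x k ^ Poly_Mapping.lookup i k))"

definition poly_subst :: "real_mpoly \<Rightarrow> (nat \<Rightarrow> real_mpoly) \<Rightarrow> real_mpoly" where
  "poly_subst p q =
     (\<Sum>i \<in> Poly_Mapping.keys p. poly_const (Poly_Mapping.lookup p i) *
        (\<Prod>k \<in> Poly_Mapping.keys i. q k ^ Poly_Mapping.lookup i k))"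

text \<open>The polynomial \<open>p\<close> with a bar: the average of \<open>p(x\<^bsub>\<pi>(1)\<^esub>, \<dots>, x\<^bsub>\<pi>(d)\<^esub>)\<close> over all \<open>\<pi>\<close>.\<close>

definition symmetrization :: "nat \<Rightarrow> real_mpoly \<Rightarrow> real_mpoly" where
  "symmetrization d p =
     poly_const (1 / fact d) *
       (\<Sum>\<pi> | \<pi> permutes {1..d}. poly_subst p (\<lambda>k. poly_var (\<pi> k)))"

section \<open>Stieltjes moment sequences\<close>

definition measure_support :: "real measure \<Rightarrow> real set" where
  "measure_support \<mu> = {x. \<forall>U. open U \<and> x \<in> U \<longrightarrow> emeasure \<mu> U > 0}"

definition stieltjes_moment_sequence :: "(nat \<Rightarrow> real) \<Rightarrow> bool" where
  "stieltjes_moment_sequence \<alpha> \<longleftrightarrow>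
     (\<exists>\<mu> :: real measure. sets \<mu> = sets borel \<and> measure_support \<mu> \<subseteq> {0..} \<and>
        (\<forall>n. set_integrable \<mu> {0..} (\<lambda>x. x ^ n) \<and> \<alpha> n = (LINT x:{0..}|\<mu>. x ^ n)))"

text \<open>
  The number \<open>d\<close> of variables is an argument of the operator, as a variable not occurring in a
  monomial (\<open>i\<^sub>k = 0\<close>) contributes a factor \<open>\<alpha>\<^sub>n\<close>, not \<open>1\<close>.
\<close>

definition T_op :: "nat \<Rightarrow> real_mpoly \<Rightarrow> (nat \<Rightarrow> real) \<Rightarrow> (nat \<Rightarrow> real)" where
  "T_op d p \<alpha> = (\<lambda>n. \<Sum>i \<in> Poly_Mapping.keys p. Poly_Mapping.lookup p i *
     (\<Prod>k = 1..d. \<alpha> (n + Poly_Mapping.lookup i k)))"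

definition stieltjes_moment_property :: "((nat \<Rightarrow> real) \<Rightarrow> (nat \<Rightarrow> real)) \<Rightarrow> bool" where
  "stieltjes_moment_property T \<longleftrightarrow>
     (\<forall>\<alpha>. stieltjes_moment_sequence \<alpha> \<longrightarrow> stieltjes_moment_sequence (T \<alpha>))"

section \<open>The symmetrization evaluates as expected\<close>

lemma poly_eval_superset:
  assumes "finite K" "Poly_Mapping.keys p \<subseteq> K"
  shows "poly_eval p x = (\<Sum>i\<in>K. Poly_Mapping.lookup p i *
        (\<Prod>k \<in> Poly_Mapping.keys i. x k ^ Poly_Mapping.lookup i k))"
  unfolding poly_eval_def
  by (rule sum.mono_neutral_left) (use assms in \<open>auto simp: in_keys_iff\<close>)

lemma poly_eval_zero [simp]: "poly_eval 0 x = 0"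
  by (simp add: poly_eval_def)

lemma poly_eval_add: "poly_eval (p + q) x = poly_eval p x + poly_eval q x"
proof -
  let ?K = "Poly_Mapping.keys p \<union> Poly_Mapping.keys q"
  have "Poly_Mapping.keys (p + q) \<subseteq> ?K" by (rule Poly_Mapping.keys_add)
  then show ?thesis
    by (subst (1 2 3) poly_eval_superset[of ?K])
      (auto simp: lookup_add sum.distrib algebra_simps)
qed

lemma poly_eval_sum: "poly_eval (sum f A) x = (\<Sum>a\<in>A. poly_eval (f a) x)"
  by (induction A rule: infinite_finite_induct) (auto simp: poly_eval_add)

lemma poly_eval_single:
  "poly_eval (Poly_Mapping.single i c) x =
     c * (\<Prod>k \<in> Poly_Mapping.keys i. x k ^ Poly_Mapping.lookup i k)"
  by (simp add: poly_eval_def)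

lemma monomial_eval_add:
  fixes i j :: "nat \<Rightarrow>\<^sub>0 nat" and x :: "nat \<Rightarrow> real"
  shows "(\<Prod>k \<in> Poly_Mapping.keys (i + j). x k ^ Poly_Mapping.lookup (i + j) k) =
    (\<Prod>k \<in> Poly_Mapping.keys i. x k ^ Poly_Mapping.lookup i k) *
    (\<Prod>k \<in> Poly_Mapping.keys j. x k ^ Poly_Mapping.lookup j k)"
proof -
  let ?K = "Poly_Mapping.keys i \<union> Poly_Mapping.keys j"
  have *: "(\<Prod>k \<in> Poly_Mapping.keys l. x k ^ Poly_Mapping.lookup l k) =
      (\<Prod>k \<in> ?K. x k ^ Poly_Mapping.lookup l k)" if "Poly_Mapping.keys l \<subseteq> ?K" for l
    by (rule prod.mono_neutral_left) (use that in \<open>auto simp: in_keys_iff\<close>)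
  have "Poly_Mapping.keys (i + j) \<subseteq> ?K" by (rule Poly_Mapping.keys_add)
  then show ?thesis
    unfolding *[OF \<open>Poly_Mapping.keys (i + j) \<subseteq> ?K\<close>] *[OF Un_upper1] *[OF Un_upper2]
    by (simp add: lookup_add power_add prod.distrib)
qed

lemma poly_mapping_sum_singles:
  "(p :: real_mpoly) = (\<Sum>i\<in>Poly_Mapping.keys p. Poly_Mapping.single i (Poly_Mapping.lookup p i))"
  by (rule poly_mapping_eqI)
    (auto simp: lookup_sum lookup_single when_def in_keys_iff sum.delta)

lemma poly_eval_mult: "poly_eval (p * q) x = poly_eval p x * poly_eval q x"
proof -
  have "p * q = (\<Sum>i\<in>Poly_Mapping.keys p. \<Sum>j\<in>Poly_Mapping.keys q.
      Poly_Mapping.single (i + j) (Poly_Mapping.lookup p i * Poly_Mapping.lookup q j))"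
    by (subst poly_mapping_sum_singles[of p], subst poly_mapping_sum_singles[of q])
      (simp add: sum_product mult_single)
  then show ?thesis
    by (simp add: poly_eval_sum poly_eval_single monomial_eval_add)
      (simp add: poly_eval_def sum_product mult_ac)
qed

lemma poly_eval_const [simp]: "poly_eval (poly_const c) x = c"
  by (simp add: poly_const_def poly_eval_single)

lemma poly_eval_var [simp]: "poly_eval (poly_var k) x = x k"
  by (simp add: poly_var_def poly_eval_single)

lemma poly_eval_one [simp]: "poly_eval 1 x = 1"
  using poly_eval_const[of 1 x] by (simp add: poly_const_def)

lemma poly_eval_power: "poly_eval (p ^ n) x = poly_eval p x ^ n"
  by (induction n) (auto simp: poly_eval_mult)

lemma poly_eval_prod: "poly_eval (prod f A) x = (\<Prod>a\<in>A. poly_eval (f a) x)"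
  by (induction A rule: infinite_finite_induct) (auto simp: poly_eval_mult)

lemma poly_eval_subst: "poly_eval (poly_subst p q) x = poly_eval p (\<lambda>k. poly_eval (q k) x)"
  by (simp add: poly_subst_def poly_eval_sum poly_eval_mult poly_eval_prod poly_eval_power)
    (simp add: poly_eval_def)

lemma poly_eval_symmetrization:
  "poly_eval (symmetrization d p) x =
     1 / fact d * (\<Sum>\<pi> | \<pi> permutes {1..d}. poly_eval p (\<lambda>k. x (\<pi> k)))"
  by (simp add: symmetrization_def poly_eval_mult poly_eval_sum poly_eval_subst)

end

theory Submission
  imports Defs
begin

text \<open>
  Let \<open>\<alpha>\<close> be the moment sequence of \<open>\<mu>\<close> on \<open>[0,\<infinity>)\<close>. By Fubini, \<open>T\<^sub>p(\<alpha>)\<^sub>n\<close> is the integral of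
  \<open>(x\<^sub>1 \<cdots> x\<^sub>d)\<^sup>n p(x)\<close> against the \<open>d\<close>-fold product of \<open>\<mu>\<close>. As the product measure and the first
  factor are symmetric, \<open>p\<close> may be replaced by its symmetrization \<open>q\<close>. If \<open>q \<ge> 0\<close>, then the image
  of the measure with density \<open>q\<close> under \<open>x \<mapsto> x\<^sub>1 \<cdots> x\<^sub>d\<close> represents \<open>T\<^sub>p(\<alpha>)\<close>.
\<close>

text \<open>The representing measure is the image under \<open>g\<close> of the measure with density
  \<open>f\<close>; nonnegativity of \<open>g\<close> places its support in
  \<open>{0..}\<close>.\<close>

lemma stieltjes_moment_sequence_weighted_powers:
  fixes f g :: "'a \<Rightarrow> real"
  assumes [measurable]: "f \<in> borel_measurable M" "g \<in> borel_measurable M"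
    and f: "\<And>x. x \<in> space M \<Longrightarrow> 0 \<le> f x"
    and g: "\<And>x. x \<in> space M \<Longrightarrow> 0 \<le> g x"
    and int: "\<And>n. integrable M (\<lambda>x. g x ^ n * f x)"
  shows "stieltjes_moment_sequence (\<lambda>n. \<integral>x. g x ^ n * f x \<partial>M)"
  unfolding stieltjes_moment_sequence_def
proof (intro exI conjI allI)
  let ?D = "density M f"
  let ?N = "distr ?D borel g"
  have AE_f: "AE x in M. 0 \<le> f x" using f by (intro AE_I2)
  show "sets ?N = sets borel" by simp
  show "measure_support ?N \<subseteq> {0..}"
  proof (rule ccontr)
    assume "\<not> measure_support ?N \<subseteq> {0..}"
    \<comment> \<open>A negative support point would give the open set \<open>{..<0}\<close>
      positive mass, although its preimage under \<open>g\<close> is empty.\<close>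
    then obtain x where "x \<in> measure_support ?N" "x < 0" by fastforce
    then have "emeasure ?N {..<0} > 0" unfolding measure_support_def by auto
    moreover have "g -` {..<0} \<inter> space M = {}" using g by fastforce
    ultimately show False by (simp add: emeasure_distr)
  qed
  fix n
  let ?h = "\<lambda>y::real. indicat_real {0..} y *\<^sub>R y ^ n"
  have eq: "f x *\<^sub>R ?h (g x) = g x ^ n * f x" if "x \<in> space M" for x
    using g[OF that] by simp
  have "integrable M (\<lambda>x. f x *\<^sub>R ?h (g x))"
    using int[of n] eq by (subst Bochner_Integration.integrable_cong[OF refl]) auto
  then have "integrable ?D (\<lambda>x. ?h (g x))"
    using AE_f by (subst integrable_density) auto
  then show "set_integrable ?N {0..} (\<lambda>x. x ^ n)"
    unfolding set_integrable_def by (subst integrable_distr_eq) auto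
  have "(LINT x:{0..}|?N. x ^ n) = (\<integral>x. ?h (g x) \<partial>?D)"
    unfolding set_lebesgue_integral_def by (subst integral_distr) auto
  also have "\<dots> = (\<integral>x. f x *\<^sub>R ?h (g x) \<partial>M)"
    using AE_f by (subst integral_density) auto
  also have "\<dots> = (\<integral>x. g x ^ n * f x \<partial>M)"
    by (rule Bochner_Integration.integral_cong) (simp_all only: eq)
  finally show "(\<integral>x. g x ^ n * f x \<partial>M) = (LINT x:{0..}|?N. x ^ n)" by simp
qed

text \<open>Variables missing from a monomial contribute \<open>x k ^ 0 = 1\<close>, so each product
  extends to \<open>{1..d}\<close>, the index range in \<open>T_op\<close>.\<close>

lemma poly_eval_polynomials_in:
  assumes "p \<in> polynomials_in d"
  shows "poly_eval p x = (\<Sum>i\<in>Poly_Mapping.keys p. Poly_Mapping.lookup p i *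
    (\<Prod>k=1..d. x k ^ Poly_Mapping.lookup i k))"
  unfolding poly_eval_def
proof (intro sum.cong refl arg_cong2[where f = "(*)"])
  fix i assume "i \<in> Poly_Mapping.keys p"
  with assms have "Poly_Mapping.keys i \<subseteq> {1..d}" by (auto simp: polynomials_in_def)
  then show "(\<Prod>k\<in>Poly_Mapping.keys i. x k ^ Poly_Mapping.lookup i k) =
      (\<Prod>k=1..d. x k ^ Poly_Mapping.lookup i k)"
    by (intro prod.mono_neutral_left) (auto simp: in_keys_iff)
qed

text \<open>Permuting the variables moves the exponents by \<open>inv \<pi>\<close>. Fubini then
  gives a product of one-dimensional integrals, whose order is irrelevant, so the value does not
  depend on \<open>\<pi>\<close>.\<close>

lemma has_bochner_integral_permuted_monomial:
  fixes M :: "real measure" and e :: "nat \<Rightarrow> nat"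
  assumes "sigma_finite_measure M"
    and int: "\<And>n. integrable M (\<lambda>x. x ^ n)"
    and \<pi>: "\<pi> permutes {1..d}"
  shows "has_bochner_integral (PiM {1..d} (\<lambda>_. M))
    (\<lambda>x. \<Prod>k=1..d. x (\<pi> k) ^ e k) (\<Prod>k=1..d. \<integral>t. t ^ e k \<partial>M)"
proof -
  interpret product_sigma_finite "\<lambda>_::nat. M"
    using assms(1) by (simp add: product_sigma_finite_def)
  let ?e = "\<lambda>k. e (inv \<pi> k)"
  have "has_bochner_integral (PiM {1..d} (\<lambda>_. M))
      (\<lambda>x. \<Prod>k=1..d. x k ^ ?e k) (\<Prod>k=1..d. \<integral>t. t ^ ?e k \<partial>M)"
    unfolding has_bochner_integral_iff
    using product_integrable_prod[of "{1..d}" "\<lambda>k t. t ^ ?e k"]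
      product_integral_prod[of "{1..d}" "\<lambda>k t. t ^ ?e k"] int
    by simp
  \<comment> \<open>A general \<open>F\<close> lets the same reindexing serve both the integrand and
    the product of integrals.\<close>
  moreover have reindex: "(\<Prod>k=1..d. F k (?e k)) = (\<Prod>k=1..d. F (\<pi> k) (e k))"
    for F :: "nat \<Rightarrow> nat \<Rightarrow> real"
    using prod.permute[OF \<pi>, of "\<lambda>k. F k (?e k)"] permutes_inverses(2)[OF \<pi>] by (simp add: o_def)
  ultimately show ?thesis
    by (simp only: reindex[of "\<lambda>k m. \<integral>t. t ^ m \<partial>M"] reindex[of "\<lambda>k m. x k ^ m" for x])
qed

text \<open>Each of the \<open>fact d\<close> permutations contributes the same integral, so
  averaging leaves the value of \<open>T_op\<close> unchanged.\<close>

lemma has_bochner_integral_T_op: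
  fixes M :: "real measure"
  assumes p: "p \<in> polynomials_in d"
    and M: "sigma_finite_measure M"
    and int: "\<And>n. integrable M (\<lambda>x. x ^ n)"
  shows "has_bochner_integral (PiM {1..d} (\<lambda>_. M))
    (\<lambda>x. (\<Prod>k=1..d. x k) ^ n * poly_eval (symmetrization d p) x)
    (T_op d p (\<lambda>m. \<integral>t. t ^ m \<partial>M) n)"
proof -
  let ?P = "{\<pi>. \<pi> permutes {1..d}}"
  let ?T = "T_op d p (\<lambda>m. \<integral>t. t ^ m \<partial>M) n"
  have perm: "has_bochner_integral (PiM {1..d} (\<lambda>_. M))
      (\<lambda>x. (\<Prod>k=1..d. x k) ^ n * poly_eval p (\<lambda>k. x (\<pi> k))) ?T" if "\<pi> \<in> ?P" for \<pi>
  proof -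
    have \<pi>: "\<pi> permutes {1..d}" using that by simp
    \<comment> \<open>The product of all coordinates is invariant under \<open>\<pi>\<close>, so its
      power joins the permuted monomial and produces the index shift by \<open>n\<close>.\<close>
    have "(\<Prod>k=1..d. x k) ^ n * poly_eval p (\<lambda>k. x (\<pi> k)) =
      (\<Sum>i\<in>Poly_Mapping.keys p. Poly_Mapping.lookup p i *
        (\<Prod>k=1..d. x (\<pi> k) ^ (n + Poly_Mapping.lookup i k)))" for x :: "nat \<Rightarrow> real"
      unfolding poly_eval_polynomials_in[OF p] prod.permute[OF \<pi>, of x]
      by (simp add: o_def sum_distrib_left power_add prod.distrib prod_power_distrib mult_ac)
    then show ?thesis
      unfolding T_op_def
      by (simp only:)
        (intro has_bochner_integral_sum has_bochner_integral_mult_right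
          has_bochner_integral_permuted_monomial M int \<pi>)
  qed
  have "has_bochner_integral (PiM {1..d} (\<lambda>_. M))
      (\<lambda>x. 1 / fact d * (\<Sum>\<pi>\<in>?P. (\<Prod>k=1..d. x k) ^ n * poly_eval p (\<lambda>k. x (\<pi> k))))
      (1 / fact d * (\<Sum>\<pi>\<in>?P. ?T))"
    by (intro has_bochner_integral_mult_right has_bochner_integral_sum perm)
  moreover have "card ?P = fact d" by (rule card_permutations) auto
  ultimately show ?thesis
    by (simp add: poly_eval_symmetrization sum_distrib_left mult_ac)
qed

theorem corollary3p3:
  fixes d :: nat and p :: real_mpoly
  assumes "d \<ge> 1"
    and "p \<in> polynomials_in d"
    and "\<And>x :: nat \<Rightarrow> real. (\<forall>k\<in>{1..d}. 0 \<le> x k) \<Longrightarrow> 0 \<le> poly_eval (symmetrization d p) x"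
  shows "stieltjes_moment_property (T_op d p)"
  unfolding stieltjes_moment_property_def
proof (intro allI impI)
  fix \<alpha> assume "stieltjes_moment_sequence \<alpha>"
  then obtain \<mu> :: "real measure" where \<mu>: "sets \<mu> = sets borel"
    and int_\<mu>: "\<And>n. set_integrable \<mu> {0..} (\<lambda>x. x ^ n)"
    and \<alpha>: "\<And>n. \<alpha> n = (LINT x:{0..}|\<mu>. x ^ n)"
    unfolding stieltjes_moment_sequence_def by blast
  \<comment> \<open>On the restricted space, set integrals become plain integrals and all points of
    the product space have nonnegative coordinates.\<close>
  define M where "M = restrict_space \<mu> {0..}"
  have sets: "{0..} \<inter> space \<mu> \<in> sets \<mu>" using \<mu> sets_eq_imp_space_eq[OF \<mu>] by simp
  have space: "space M = {0..}"
    using sets_eq_imp_space_eq[OF \<mu>] by (simp add: M_def space_restrict_space)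
  have int: "integrable M (\<lambda>x. x ^ n)" for n
    using int_\<mu>[of n] sets by (simp add: M_def integrable_restrict_space set_integrable_def)
  have \<alpha>_M: "\<alpha> = (\<lambda>n. \<integral>t. t ^ n \<partial>M)"
    using \<alpha> sets by (simp add: M_def integral_restrict_space set_lebesgue_integral_def fun_eq_iff)
  \<comment> \<open>The zeroth moment is the total mass.\<close>
  have "finite_measure M"
    using int[of 0] by (intro finite_measureI) (auto simp: integrable_iff_bounded)
  then have M: "sigma_finite_measure M" by (simp add: finite_measure_def)
  have [measurable]: "(\<lambda>x. x) \<in> borel_measurable M"
    using borel_measurable_integrable[OF int[of 1]] by simp
  let ?Q = "PiM {1..d} (\<lambda>_. M)"
  note has_int = has_bochner_integral_T_op[OF assms(2) M int]
  have nonneg: "0 \<le> x k" if "x \<in> space ?Q" "k \<in> {1..d}" for x k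
    using that space by (auto simp: space_PiM PiE_iff)
  have "stieltjes_moment_sequence
      (\<lambda>n. \<integral>x. (\<Prod>k=1..d. x k) ^ n * poly_eval (symmetrization d p) x \<partial>?Q)"
  proof (rule stieltjes_moment_sequence_weighted_powers)
    \<comment> \<open>For \<open>n = 0\<close> the integrand is the symmetrization itself, so its
      integrability yields measurability.\<close>
    show "poly_eval (symmetrization d p) \<in> borel_measurable ?Q"
      using has_int[of 0] by (auto simp: has_bochner_integral_iff)
    show "(\<lambda>x. \<Prod>k=1..d. x k) \<in> borel_measurable ?Q"
    proof (rule borel_measurable_prod)
      fix k assume "k \<in> {1..d}"
      then show "(\<lambda>x. x k) \<in> borel_measurable ?Q"
        by (intro measurable_compose[OF measurable_component_singleton]) auto
    qed
  qed (use assms(3) nonneg has_int in \<open>auto simp: has_bochner_integral_iff intro!: prod_nonneg\<close>)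
  then show "stieltjes_moment_sequence (T_op d p \<alpha>)"
    using has_int by (simp add: \<alpha>_M has_bochner_integral_iff)
qed

end
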